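(* Let $f=(f_1,\dots,f_K)$ be feature locations $f_j:V\to\mathbb{R}$ and let $\Delta_f=-\sum_{j\in[K]}\nabla_{f_j}^2$ be the Schrödinger Laplacian. Let $g^{(0)}:V\to\mathbb{C}$ be a normalized signal (i.e. $\|g^{(0)}\|_2=1$) and $g^{(t)}=\mathcal{S}[t,f]g^{(0)}$ with $\mathcal{S}[t,f]=e^{-it\Delta_f}$, $t\in\mathbb{R}$. Then for every $k\in[K]$, $$\frac{\partial}{\partial t}\mathcal{E}_{X_{f_k}}(g^{(t)})=2\,\mathrm{Re}\left(\langle i\nabla_{f_k}g^{(t)},W_{f_k}g^{(t)}\rangle\right)-\sum_{j\neq k}\left\langle[i\nabla_{f_j}^2,X_{f_k}]g^{(t)},g^{(t)}\right\rangle.$$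
   Context: $\mathcal{G}=(V,E)$ is a finite undirected weighted graph with $V=[N]=\{1,\dots,N\}$, $E\subset[N]^2$, and real symmetric adjacency matrix $A=(a_{n,m})\in\mathbb{R}^{N\times N}$ with $a_{n,m}=0$ whenever $n,m$ are not joined by an edge; $\mathcal{N}(v)$ is the neighborhood of $v$. Signals $g:V\to\mathbb{C}$ are identified with vectors in $\mathbb{C}^N$, with $\langle u,g\rangle=\sum_{v\in V}u(v)\overline{g(v)}$ and $\|g\|_2^2=\langle g,g\rangle$. For $\varphi:V\to\mathbb{R}$: the partial derivative $\nabla_\varphi\in\mathbb{C}^{N\times N}$ has entries $(\nabla_\varphi)_{n,m}=a_{n,m}(\varphi(n)-\varphi(m))$; the location observable is $X_\varphi=\mathrm{diag}(\varphi)$; the smoothing operator is $(W_\varphi g)(v)=\sum_{w\in\mathcal{N}(v)}a_{v,w}(\varphi(w)-\varphi(v))^2g(w)$. For a self-adjoint operator $M$ and a normalized signal $g$, $\mathcal{E}_M(g)=\langle Mg,g\rangle$. The commutator is $[M,Y]=MY-YM$, and $[K]=\{1,\dots,K\}$. *)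

theory Defs
  imports "HOL-Analysis.Analysis"
begin

(* The vertex set is the (finite, nonempty, otherwise arbitrary) index type 'n, with N = CARD('n).
   E is a set of ordered pairs, so an undirected edge appears in both orientations.
   Self-loops are not excluded. *)
definition weighted_graph :: "('n \<times> 'n) set \<Rightarrow> real^'n^'n \<Rightarrow> bool" where
  "weighted_graph E A \<longleftrightarrow>
     sym E \<and> transpose A = A \<and> (\<forall>n m. (n, m) \<notin> E \<longrightarrow> A $ n $ m = 0)"

definition nbhd :: "('n \<times> 'n) set \<Rightarrow> 'n \<Rightarrow> 'n set" where
  "nbhd E v = {w. (v, w) \<in> E}"

(* Complex-valued, conjugate-linear in the second argument; the library's inner product
   on complex^'n is only the real part of it. *)
definition cinner :: "complex^'n \<Rightarrow> complex^'n \<Rightarrow> complex" where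
  "cinner u g = (\<Sum>v\<in>UNIV. u $ v * cnj (g $ v))"

lemma cinner_self: "cinner g g = complex_of_real ((norm g)\<^sup>2)"
  by (simp add: cinner_def norm_vec_def L2_set_def sum_nonneg flip: complex_norm_square)

definition cscale :: "complex \<Rightarrow> complex^'n^'n \<Rightarrow> complex^'n^'n" where
  "cscale c M = map_matrix ((*) c) M"

definition grad :: "real^'n^'n \<Rightarrow> ('n \<Rightarrow> real) \<Rightarrow> complex^'n^'n" where
  "grad A \<phi> = (\<chi> n m. complex_of_real (A $ n $ m * (\<phi> n - \<phi> m)))"

definition location :: "('n \<Rightarrow> real) \<Rightarrow> complex^'n^'n" where
  "location \<phi> = (\<chi> n m. if n = m then complex_of_real (\<phi> n) else 0)"

definition smoothing ::
  "('n \<times> 'n) set \<Rightarrow> real^'n^'n \<Rightarrow> ('n \<Rightarrow> real) \<Rightarrow> complex^'n \<Rightarrow> complex^'n" where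
  "smoothing E A \<phi> g =
     (\<chi> v. \<Sum>w\<in>nbhd E v. complex_of_real (A $ v $ w * (\<phi> w - \<phi> v)\<^sup>2) * g $ w)"

definition expectation :: "complex^'n^'n \<Rightarrow> complex^'n \<Rightarrow> complex" where
  "expectation M g = cinner (M *v g) g"

definition commutator :: "complex^'n^'n \<Rightarrow> complex^'n^'n \<Rightarrow> complex^'n^'n" where
  "commutator M Y = M ** Y - Y ** M"

(* The class instances for vectors make * and ^ on matrices entrywise, so powers and the
   exponential series are spelled out with the matrix product **. *)
primrec matpow :: "complex^'n^'n \<Rightarrow> nat \<Rightarrow> complex^'n^'n" where
  "matpow M 0 = mat 1"
| "matpow M (Suc k) = M ** matpow M k"

definition matexp :: "complex^'n^'n \<Rightarrow> complex^'n^'n" where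
  "matexp M = (\<Sum>k. (1 / fact k) *\<^sub>R matpow M k)"

(* Only f 1, ..., f K are used. *)
definition schroedinger_laplacian ::
  "real^'n^'n \<Rightarrow> nat \<Rightarrow> (nat \<Rightarrow> 'n \<Rightarrow> real) \<Rightarrow> complex^'n^'n" where
  "schroedinger_laplacian A K f = - (\<Sum>j\<in>{1..K}. matpow (grad A (f j)) 2)"

definition evolution ::
  "real^'n^'n \<Rightarrow> nat \<Rightarrow> real \<Rightarrow> (nat \<Rightarrow> 'n \<Rightarrow> real) \<Rightarrow> complex^'n^'n" where
  "evolution A K t f = matexp (cscale (- \<i> * complex_of_real t) (schroedinger_laplacian A K f))"

end

theory Submission
  imports Defs
begin

text \<open>With \<open>P = \<Sum>\<^sub>j \<nabla>\<^sub>j\<^sup>2\<close> the signal solves \<open>g' = i P g\<close>. Each \<open>\<nabla>\<^sub>j\<close> is skew-adjoint, so \<open>i P\<close> is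
  skew-adjoint too and the expectation of \<open>X\<close> has derivative \<open>- \<langle>[i P, X] g, g\<rangle>\<close>, a sum over \<open>j\<close>.
  For the term \<open>j = k\<close> one uses \<open>[\<nabla>\<^sub>k, X\<^sub>k] = - W\<^sub>k\<close>, hence
  \<open>[\<nabla>\<^sub>k\<^sup>2, X\<^sub>k] = - (\<nabla>\<^sub>k W\<^sub>k + W\<^sub>k \<nabla>\<^sub>k)\<close>, together with the self-adjointness of \<open>W\<^sub>k\<close>.
  The derivative of the matrix exponential is computed entrywise, as that of a complex power series.\<close>

section \<open>The matrix exponential: entrywise convergence and derivative\<close>

lemma matrix_mult_scaleR_right:
  fixes M N :: "complex^'n^'n"
  shows "M ** (r *\<^sub>R N) = r *\<^sub>R (M ** N)"
  by (simp add: vec_eq_iff matrix_matrix_mult_def scaleR_sum_right)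

lemma matrix_mult_scaleR_left:
  fixes M N :: "complex^'n^'n"
  shows "(r *\<^sub>R M) ** N = r *\<^sub>R (M ** N)"
  by (simp add: vec_eq_iff matrix_matrix_mult_def scaleR_sum_right)

lemma matpow_scaleR: "matpow (r *\<^sub>R M) k = r ^ k *\<^sub>R matpow M k"
  by (induction k) (simp_all add: matrix_mult_scaleR_right matrix_mult_scaleR_left)

text \<open>An entry of a product sums CARD('n) terms, so each further factor \<open>M\<close> costs
  at most CARD('n) * b. This geometric growth is what the factorials have to beat.\<close>

lemma norm_matpow_nth_le:
  fixes M :: "complex^'n::finite^'n"
  assumes "\<And>i j. norm (M $ i $ j) \<le> b" and "1 \<le> b"
  shows "norm (matpow M k $ i $ j) \<le> (real CARD('n) * b) ^ k"
proof (induction k arbitrary: i j)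
  case 0
  then show ?case by (simp add: mat_def)
next
  case (Suc k)
  have "norm (matpow M (Suc k) $ i $ j) \<le> (\<Sum>l\<in>UNIV. norm (M $ i $ l * matpow M k $ l $ j))"
    by (simp add: matrix_matrix_mult_def norm_sum)
  also have "\<dots> \<le> (\<Sum>l\<in>(UNIV :: 'n set). b * (real CARD('n) * b) ^ k)"
    using assms Suc.IH by (intro sum_mono) (auto simp: norm_mult intro!: mult_mono)
  finally show ?case by (simp add: mult_ac)
qed

lemma summable_matpow_nth:
  fixes M :: "complex^'n::finite^'n"
  shows "summable (\<lambda>k. (matpow M k $ i $ j / fact k) * z ^ k)"
proof -
  \<comment> \<open>The double sum dominates every single entry; the added 1 secures
    \<open>1 \<le> b\<close>.\<close>
  define b where "b = 1 + (\<Sum>i\<in>UNIV. \<Sum>j\<in>UNIV. norm (M $ i $ j))"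
  have "norm (M $ i $ j) \<le> (\<Sum>j\<in>UNIV. norm (M $ i $ j))" for i j
    by (rule member_le_sum) auto
  also have "(\<Sum>j\<in>UNIV. norm (M $ i $ j)) \<le> (\<Sum>i\<in>UNIV. \<Sum>j\<in>UNIV. norm (M $ i $ j))" for i
    by (rule member_le_sum[of i UNIV "\<lambda>i. \<Sum>j\<in>UNIV. norm (M $ i $ j)"]) (auto intro: sum_nonneg)
  finally have le: "norm (M $ i $ j) \<le> b" for i j
    unfolding b_def by (simp add: add_increasing)
  have b1: "1 \<le> b"
    unfolding b_def by (simp add: sum_nonneg)
  let ?c = "real CARD('n) * b"
  show ?thesis
  proof (rule summable_comparison_test')
    show "summable (\<lambda>k. inverse (fact k) * (?c * norm z) ^ k)"
      by (rule summable_exp)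
    fix k :: nat
    have "norm ((matpow M k $ i $ j / fact k) * z ^ k)
        = inverse (fact k) * (norm (matpow M k $ i $ j) * norm z ^ k)"
      by (simp add: norm_mult norm_divide norm_power divide_simps)
    also have "\<dots> \<le> inverse (fact k) * (?c ^ k * norm z ^ k)"
      using norm_matpow_nth_le[of M b k i j, OF le b1]
      by (intro mult_left_mono mult_right_mono) auto
    finally show "norm ((matpow M k $ i $ j / fact k) * z ^ k)
        \<le> inverse (fact k) * (?c * norm z) ^ k"
      by (simp add: power_mult_distrib)
  qed
qed

text \<open>The matrix series converges because each of its entries does, so the infinite sum can be
  read off entrywise. A real \<open>s\<close> then becomes a complex argument of an everywhere
  convergent power series.\<close>

lemma matexp_scaleR_nth:
  fixes M :: "complex^'n::finite^'n"
  shows "matexp (s *\<^sub>R M) $ i $ j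
    = (\<Sum>k. (matpow M k $ i $ j / fact k) * complex_of_real s ^ k)"
proof -
  let ?S = "\<lambda>i j. \<Sum>k. (matpow M k $ i $ j / fact k) * complex_of_real s ^ k"
  have eq: "((1 / fact k) *\<^sub>R matpow (s *\<^sub>R M) k) $ i $ j
      = (matpow M k $ i $ j / fact k) * complex_of_real s ^ k" for k i j
    by (simp add: matpow_scaleR scaleR_conv_of_real[where 'a = complex] divide_simps)
  have "(\<lambda>k. (1 / fact k) *\<^sub>R matpow (s *\<^sub>R M) k) sums (\<chi> i j. ?S i j)"
    unfolding sums_def
  proof (intro vec_tendstoI)
    fix i j
    have "(\<lambda>k. ((1 / fact k) *\<^sub>R matpow (s *\<^sub>R M) k) $ i $ j) sums ?S i j"
      unfolding eq by (rule summable_sums[OF summable_matpow_nth])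
    then show "(\<lambda>n. (\<Sum>k<n. (1 / fact k) *\<^sub>R matpow (s *\<^sub>R M) k) $ i $ j)
        \<longlonglongrightarrow> (\<chi> i j. ?S i j) $ i $ j"
      by (simp add: sums_def)
  qed
  then show ?thesis
    unfolding matexp_def by (simp add: sums_iff)
qed

lemma has_vector_derivative_matexp_nth:
  fixes M :: "complex^'n::finite^'n"
  shows "((\<lambda>s. matexp (s *\<^sub>R M) $ i $ j) has_vector_derivative
    (M ** matexp (s *\<^sub>R M)) $ i $ j) (at s)"
proof -
  let ?c = "\<lambda>i k. matpow M k $ i $ j / fact k"
  \<comment> \<open>The factor k + 1 from differentiation cancels against the factorial of k + 1.
    What remains is an entry of \<open>M ** matpow M k\<close>, expanded as a sum over the inner
    index \<open>l\<close>.\<close>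
  have diffs: "diffs (?c i) k * z ^ k = (\<Sum>l\<in>UNIV. M $ i $ l * (?c l k * z ^ k))" for k z
  proof -
    have "diffs (?c i) k = matpow M (Suc k) $ i $ j / fact k"
      by (simp add: diffs_def divide_simps del: of_nat_Suc)
    then show ?thesis
      by (simp add: matrix_matrix_mult_def sum_divide_distrib sum_distrib_right mult.assoc)
  qed
  have "((\<lambda>z. \<Sum>k. ?c i k * z ^ k) has_field_derivative
      (\<Sum>k. diffs (?c i) k * complex_of_real s ^ k)) (at (complex_of_real s))"
    by (rule termdiffs_strong_converges_everywhere) (rule summable_matpow_nth)
  also have "(\<Sum>k. diffs (?c i) k * complex_of_real s ^ k)
      = (\<Sum>l\<in>UNIV. \<Sum>k. M $ i $ l * (?c l k * complex_of_real s ^ k))"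
    unfolding diffs by (intro suminf_sum summable_mult summable_matpow_nth)
  also have "\<dots> = (\<Sum>l\<in>UNIV. M $ i $ l * matexp (s *\<^sub>R M) $ l $ j)"
    unfolding matexp_scaleR_nth
    by (intro sum.cong refl suminf_mult summable_matpow_nth)
  also have "\<dots> = (M ** matexp (s *\<^sub>R M)) $ i $ j"
    by (simp add: matrix_matrix_mult_def)
  finally have "((\<lambda>z. \<Sum>k. ?c i k * z ^ k) has_field_derivative
      (M ** matexp (s *\<^sub>R M)) $ i $ j) (at (complex_of_real s))" .
  \<comment> \<open>The complex derivative is restricted to the real line.\<close>
  from has_vector_derivative_real_field[OF this] show ?thesis
    by (simp add: matexp_scaleR_nth)
qed

lemma has_vector_derivative_matexp_apply:
  fixes M :: "complex^'n::finite^'n"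
  shows "((\<lambda>s. matexp (s *\<^sub>R M) *v u) has_vector_derivative
    M *v (matexp (s *\<^sub>R M) *v u)) (at s)"
proof -
  have "((\<lambda>s. (matexp (s *\<^sub>R M) *v u) $ i) has_vector_derivative
      ((M ** matexp (s *\<^sub>R M)) *v u) $ i) (at s)" for i
    unfolding matrix_vector_mult_def vec_lambda_beta
    by (intro has_vector_derivative_sum has_vector_derivative_mult_left
        has_vector_derivative_matexp_nth)
  then show ?thesis
    unfolding has_vector_derivative_def
    \<comment> \<open>Pairing with a real basis vector of \<open>complex^'n\<close> picks out the
      real or imaginary part of one component, so the derivatives of the components suffice.\<close>
    by (subst has_derivative_componentwise_within)
       (auto simp: Basis_vec_def inner_axis matrix_vector_mul_assoc
         intro!: derivative_eq_intros)
qed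

section \<open>The complex inner product, adjoints and commutators\<close>

lemma cinner_simps:
  "cinner (u + v) w = cinner u w + cinner v w"
  "cinner (u - v) w = cinner u w - cinner v w"
  "cinner (- u) w = - cinner u w"
  "cinner (c *s u) w = c * cinner u w"
  "cinner u (v + w) = cinner u v + cinner u w"
  "cinner u (v - w) = cinner u v - cinner u w"
  "cinner u (- w) = - cinner u w"
  "cinner u (c *s w) = cnj c * cinner u w"
  by (simp_all add: cinner_def algebra_simps sum.distrib sum_subtractf sum_negf sum_distrib_left)

lemma cinner_sum_left: "cinner (\<Sum>j\<in>J. u j) w = (\<Sum>j\<in>J. cinner (u j) w)"
  by (simp add: cinner_def sum_distrib_right) (rule sum.swap)

lemma cnj_cinner: "cnj (cinner u w) = cinner w u"
  by (simp add: cinner_def mult.commute)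

text \<open>Conjugate-linearity is still linearity over the reals, which is enough for the product
  rule in a real time variable.\<close>

lemma bounded_bilinear_cinner: "bounded_bilinear (cinner :: complex^'n::finite \<Rightarrow> _)"
  unfolding bilinear_conv_bounded_bilinear[symmetric] bilinear_def
  by (auto intro!: linearI simp: cinner_simps)
     (simp_all add: cinner_def scaleR_sum_right)

lemma cinner_matrix_adjoint:
  fixes M H :: "complex^'n::finite^'n"
  assumes "\<And>i j. H $ j $ i = cnj (M $ i $ j)"
  shows "cinner (M *v u) w = cinner u (H *v w)"
proof -
  have "cinner (M *v u) w = (\<Sum>i\<in>UNIV. \<Sum>j\<in>UNIV. M $ i $ j * u $ j * cnj (w $ i))"
    by (simp add: cinner_def matrix_vector_mult_def sum_distrib_right)
  also have "\<dots> = (\<Sum>j\<in>UNIV. \<Sum>i\<in>UNIV. M $ i $ j * u $ j * cnj (w $ i))"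
    by (rule sum.swap)
  also have "\<dots> = cinner u (H *v w)"
    by (simp add: cinner_def matrix_vector_mult_def sum_distrib_left assms mult_ac)
  finally show ?thesis .
qed

text \<open>The weights are real and symmetric while \<phi> n - \<phi> m changes sign under
  transposition, so the gradient matrix is skew-adjoint.\<close>

lemma cinner_grad:
  assumes "transpose A = A"
  shows "cinner (grad A \<phi> *v u) w = - cinner u (grad A \<phi> *v w)"
proof -
  have "A $ j $ i = A $ i $ j" for i j
    using assms by (metis transpose_def vec_lambda_beta)
  then have "cinner (grad A \<phi> *v u) w = cinner u ((- grad A \<phi>) *v w)"
    by (intro cinner_matrix_adjoint) (simp add: grad_def algebra_simps)
  also have "(- grad A \<phi>) *v w = - (grad A \<phi> *v w)"
    by (simp add: vec_eq_iff matrix_vector_mult_def sum_negf)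
  finally show ?thesis by (simp add: cinner_simps)
qed

lemma cinner_location: "cinner (location \<phi> *v u) w = cinner u (location \<phi> *v w)"
  by (rule cinner_matrix_adjoint) (simp add: location_def)

lemma location_apply: "(location \<phi> *v u) $ v = complex_of_real (\<phi> v) * u $ v"
  by (simp add: location_def matrix_vector_mult_def if_distrib[of "\<lambda>x. x * _"] sum.delta
      cong: if_cong)

lemma cscale_apply: "cscale c M *v u = c *s (M *v u)"
  by (simp add: cscale_def map_matrix_def vec_eq_iff matrix_vector_mult_def sum_distrib_left mult_ac)

lemma commutator_apply: "commutator M Y *v u = M *v (Y *v u) - Y *v (M *v u)"
  by (simp add: commutator_def matrix_vector_mult_diff_rdistrib matrix_vector_mul_assoc)

lemma matpow_2_apply: "matpow M 2 *v u = M *v (M *v u)"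
  by (simp add: numeral_2_eq_2 matrix_vector_mul_assoc)

text \<open>The (v, w) entry of the commutator is a_{v,w} (\<phi> v - \<phi> w) (\<phi> w - \<phi>
  v), a negative square times the weight. The sum over neighbours extends to all vertices because
  weights vanish off the edges.\<close>

lemma smoothing_eq_commutator:
  assumes "weighted_graph E A"
  shows "smoothing E A \<phi> u = - (commutator (grad A \<phi>) (location \<phi>) *v u)"
proof -
  have "smoothing E A \<phi> u $ v
      = (\<Sum>w\<in>UNIV. complex_of_real (A $ v $ w * (\<phi> w - \<phi> v)\<^sup>2) * u $ w)" for v
    using assms unfolding smoothing_def vec_lambda_beta
    by (intro sum.mono_neutral_left) (auto simp: nbhd_def weighted_graph_def)
  also have "\<dots> v = complex_of_real (\<phi> v) * (grad A \<phi> *v u) $ v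
      - (grad A \<phi> *v (location \<phi> *v u)) $ v" for v
    unfolding matrix_vector_mult_def[of "grad A \<phi>"] vec_lambda_beta location_apply
    by (simp add: grad_def sum_distrib_left power2_eq_square algebra_simps flip: sum_subtractf)
  also have "\<dots> v = (- (commutator (grad A \<phi>) (location \<phi>) *v u)) $ v" for v
    by (simp add: commutator_apply location_apply)
  finally show ?thesis by (simp add: vec_eq_iff)
qed

lemma cinner_commutator_grad_square:
  assumes "weighted_graph E A"
  shows "cinner (commutator (cscale \<i> (matpow (grad A \<phi>) 2)) (location \<phi>) *v u) u
    = - complex_of_real (2 * Re (cinner (\<i> *s (grad A \<phi> *v u)) (smoothing E A \<phi> u)))"
proof -
  have A: "transpose A = A"
    using assms by (simp add: weighted_graph_def)
  let ?D = "\<lambda>u. grad A \<phi> *v u" and ?X = "\<lambda>u. location \<phi> *v u" and ?W = "smoothing E A \<phi>"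
  have W: "?W v = ?X (?D v) - ?D (?X v)" for v
    using assms by (simp add: smoothing_eq_commutator commutator_apply)
  \<comment> \<open>The commutator of a skew-adjoint and a self-adjoint operator is
    self-adjoint.\<close>
  have sa: "cinner (?W v) w = cinner v (?W w)" for v w
    by (simp add: W cinner_simps cinner_location cinner_grad[OF A])
  define z where "z = cinner (?D u) (?W u)"
  \<comment> \<open>Leibniz rule [D D, X] = D [D, X] + [D, X] D with [D, X] = - W. Moving the outer
    operators across the inner product gives \<open>cnj z\<close> and \<open>- z\<close>.\<close>
  have "cinner (?D (?D (?X u)) - ?X (?D (?D u))) u = - cinner (?D (?W u)) u - cinner (?W (?D u)) u"
    by (simp add: W matrix_vector_mult_diff_distrib cinner_simps)
  also have "\<dots> = cnj z - z"
    by (simp add: cinner_grad[OF A] sa z_def cnj_cinner)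
  finally have "cinner (?D (?D (?X u)) - ?X (?D (?D u))) u = cnj z - z" .
  moreover have "commutator (cscale \<i> (matpow (grad A \<phi>) 2)) (location \<phi>) *v u
      = \<i> *s (?D (?D (?X u)) - ?X (?D (?D u)))"
    by (simp add: commutator_apply cscale_apply matpow_2_apply vector_scalar_commute
        vector_ssub_ldistrib)
  ultimately have "cinner (commutator (cscale \<i> (matpow (grad A \<phi>) 2)) (location \<phi>) *v u) u
      = \<i> * (cnj z - z)"
    by (simp only: cinner_simps(4))
  \<comment> \<open>Both sides equal 2 Im z.\<close>
  also have "\<dots> = - complex_of_real (2 * Re (\<i> * z))"
    by (simp add: complex_eq_iff)
  finally show ?thesis
    by (simp add: z_def cinner_simps)
qed

theorem theorem11:
  fixes E :: "('n::finite \<times> 'n) set"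
    and A :: "real^'n^'n"
    and K :: nat
    and f :: "nat \<Rightarrow> 'n \<Rightarrow> real"
    and g0 :: "complex^'n"
    and g :: "real \<Rightarrow> complex^'n"
    and k :: nat
    and t :: real
  assumes "weighted_graph E A"
    and "norm g0 = 1"
    and "\<And>s. g s = evolution A K s f *v g0"
    and "k \<in> {1..K}"
  shows "((\<lambda>s. expectation (location (f k)) (g s)) has_vector_derivative
           (complex_of_real
              (2 * Re (cinner (\<i> *s (grad A (f k) *v g t)) (smoothing E A (f k) (g t))))
            - (\<Sum>j\<in>{1..K} - {k}.
                 cinner (commutator (cscale \<i> (matpow (grad A (f j)) 2)) (location (f k)) *v g t)
                        (g t))))
         (at t)"
proof -
  have A: "transpose A = A"
    using assms(1) by (simp add: weighted_graph_def)
  let ?X = "location (f k)"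
  let ?B = "\<lambda>j. cscale \<i> (matpow (grad A (f j)) 2)"
  define B where "B = (\<Sum>j\<in>{1..K}. ?B j)"
  have B_apply: "B *v u = (\<Sum>j\<in>{1..K}. ?B j *v u)" for u
    unfolding B_def by (induction K) (simp_all add: matrix_vector_mult_add_rdistrib)
  \<comment> \<open>The minus signs of the exponent and of the Laplacian cancel, leaving a real
    multiple of the fixed matrix \<open>B\<close>.\<close>
  have "cscale (- \<i> * complex_of_real s) (schroedinger_laplacian A K f) = s *\<^sub>R B" for s
    by (simp add: B_def schroedinger_laplacian_def cscale_def map_matrix_def vec_eq_iff
        sum_distrib_left scaleR_conv_of_real[where 'a = complex] sum_negf mult_ac)
  then have g: "g s = matexp (s *\<^sub>R B) *v g0" for s
    using assms(3) by (simp add: evolution_def)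
  have g': "(g has_vector_derivative B *v g t) (at t)"
    unfolding g[abs_def] by (rule has_vector_derivative_matexp_apply)
  have Xg': "((\<lambda>s. ?X *v g s) has_vector_derivative ?X *v (B *v g t)) (at t)"
    by (rule bounded_linear.has_vector_derivative[OF matrix_vector_mul_bounded_linear g'])
  \<comment> \<open>The square of a skew-adjoint matrix is self-adjoint, and the factor \<i> makes
    it skew-adjoint again. Conjugation swaps the slots so that the sum over \<open>j\<close> can be
    split in the first one.\<close>
  have skew: "cinner u (B *v w) = - cinner (B *v u) w" for u w
  proof -
    have "cinner u (?B j *v w) = - cinner (?B j *v u) w" for j
      by (simp add: cscale_apply matpow_2_apply cinner_simps cinner_grad[OF A])
    then have "cinner (?B j *v w) u = - cinner w (?B j *v u)" for j
      by (metis cnj_cinner complex_cnj_minus)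
    then have "cinner (B *v w) u = - cinner w (B *v u)"
      by (simp add: B_apply cinner_sum_left sum_negf flip: cnj_cinner[of _ w])
    then show ?thesis
      by (metis cnj_cinner complex_cnj_minus)
  qed
  have "((\<lambda>s. expectation ?X (g s)) has_vector_derivative
      cinner (?X *v g t) (B *v g t) + cinner (?X *v (B *v g t)) (g t)) (at t)"
    unfolding expectation_def
    by (rule bounded_bilinear.has_vector_derivative[OF bounded_bilinear_cinner Xg' g'])
  also have "cinner (?X *v g t) (B *v g t) + cinner (?X *v (B *v g t)) (g t)
      = - cinner (commutator B ?X *v g t) (g t)"
    by (simp add: skew commutator_apply cinner_simps)
  also have "commutator B ?X *v g t = (\<Sum>j\<in>{1..K}. commutator (?B j) ?X *v g t)"
    by (simp add: commutator_apply B_apply sum_subtractf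
        linear_sum[OF matrix_vector_mul_linear])
  also have "- cinner \<dots> (g t) = - (\<Sum>j\<in>{1..K}. cinner (commutator (?B j) ?X *v g t) (g t))"
    by (simp add: cinner_sum_left)
  \<comment> \<open>Only the term of index \<open>k\<close> pairs a gradient with its own location
    observable, so only there does the smoothing formula apply.\<close>
  also have "\<dots> = - cinner (commutator (?B k) ?X *v g t) (g t)
      - (\<Sum>j\<in>{1..K} - {k}. cinner (commutator (?B j) ?X *v g t) (g t))"
    using assms(4) by (simp add: sum.remove[of _ k])
  finally show ?thesis
    unfolding cinner_commutator_grad_square[OF assms(1)] by simp
qed

end
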